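(* Let $b=(1,0)$ and $a=(0,1)$ be the generators of $\mathcal{L}_1$. Then their action on the vertices of the tree $T_p$ is given by $$b(\omega_0\omega_1\dots\omega_m)=(\omega_0+1)\omega_1\dots\omega_m,\qquad a(\omega_0\omega_1\dots\omega_m)=\omega_0(\omega_1+\omega_0)\dots(\omega_m+\omega_{m-1}),$$ where addition is modulo $p$. These relations lead to the recursive formula $a=(a,ba,\dots,b^{p-1}a)$ describing the action of $a$ in terms of its projections on the subtrees with roots at the first level. Denoting $a_i=b^ia$, $0\le i\le p-1$, the group $\mathcal{L}_1$ is generated by the automaton with the $p$ states $a_0,\dots,a_{p-1}$.
   Context: $p$ is a fixed prime, $R=\mathbb{F}_p[x,x^{-1}]$. $\mathcal{L}_1=(\mathbb{Z}/p\mathbb{Z})\wr\mathbb{Z}=R\rtimes\mathbb{Z}$ with elements $(v,s)$, $v\in R$, $s\in\mathbb{Z}$, and multiplication $(v,s)(w,t)=(v+x^sw,s+t)$; the element of the base group with $1$ at position $0$ and zeros elsewhere is identified with $1\in R$. For $m\ge0$ let $H_m=(1-x)^mR\rtimes\mathbb{Z}\le\mathcal{L}_1$. Let $\Omega=\{0,1,\dots,p-1\}$; the $p$-regular rooted tree $T_p$ is the set $\Omega^*$ of finite words (a word is joined to its one-letter extensions). For $\omega=\omega_0\cdots\omega_{m-1}\in\Omega^*$ put $\bar\omega=\sum_{i=0}^{m-1}\omega_i(x-1)^i\in R$. The map $\omega\mapsto(\bar\omega,0)H_{|\omega|}$ identifies $T_p$ with the coset tree of the chain $\{H_m\}$ (vertices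 are the cosets $gH_m$, edges given by inclusion $gH_{m+1}\subset g'H_m$), and $\mathcal{L}_1$ acts on $T_p$ via $h\cdot gH_m=hgH_m$. The formula $a=(a,ba,\dots,b^{p-1}a)$ means that $a$ fixes each letter of the first level and acts on the subtree below the letter $i$ (identified with $T_p$ by deleting the first letter) as $b^ia$. The states of the automaton are $a_0,\dots,a_{p-1}$, viewed as automorphisms of $T_p$: reading the letter $j$ in state $a_i$ it outputs $j+i \bmod p$ and passes to state $a_j$. The group generated by the automaton is the group of automorphisms of $T_p$ generated by its states. *)

theory Defs
  imports
    "Berlekamp_Zassenhaus.Finite_Field"
    "HOL-Library.Poly_Mapping"
    "HOL-Algebra.Bij"
    "HOL-Algebra.Left_Coset"
    "HOL-Algebra.Elementary_Groups"
begin

section \<open>Laurent polynomials and the lamplighter group\<close>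

text \<open>The prime is \<open>p = CARD('p)\<close> and \<open>'p mod_ring\<close> is the field with \<open>p\<close> elements.
  Finitely supported functions on the additive monoid \<open>int\<close>, multiplied by convolution,
  are exactly the Laurent polynomials; \<open>1\<close> is the function with value \<open>1\<close> at position \<open>0\<close>.\<close>

type_synonym 'p laurent = "int \<Rightarrow>\<^sub>0 'p mod_ring"

definition xpow :: "int \<Rightarrow> 'p::prime_card laurent" where
  "xpow s = Poly_Mapping.single s 1"

definition lamplighter :: "('p::prime_card laurent \<times> int) monoid" where
  "lamplighter = \<lparr>carrier = UNIV,
     monoid.mult = (\<lambda>(v, s) (w, t). (v + xpow s * w, s + t)),
     one = (0, 0)\<rparr>"

definition Hsub :: "nat \<Rightarrow> ('p::prime_card laurent \<times> int) set" where
  "Hsub m = {((1 - xpow 1) ^ m * r, s) | r s. True}"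

section \<open>The tree of words and the coset tree\<close>

definition tree_edge :: "'l list \<Rightarrow> 'l list \<Rightarrow> bool" where
  "tree_edge u v \<longleftrightarrow> (\<exists>c. v = u @ [c] \<or> u = v @ [c])"

text \<open>As in \<^const>\<open>BijGroup\<close>, the automorphisms are functions that are \<open>undefined\<close> outside
  the vertex set \<open>lists A\<close>, and the product is composition of maps.\<close>

definition tree_aut :: "'l set \<Rightarrow> ('l list \<Rightarrow> 'l list) monoid" where
  "tree_aut A = (BijGroup (lists A))\<lparr>carrier :=
     {f \<in> Bij (lists A). f [] = [] \<and>
        (\<forall>u\<in>lists A. \<forall>v\<in>lists A. tree_edge (f u) (f v) \<longleftrightarrow> tree_edge u v)}\<rparr>"

definition word_bar :: "nat list \<Rightarrow> 'p::prime_card laurent" where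
  "word_bar w = (\<Sum>i<length w. of_nat (w ! i) * (xpow 1 - 1) ^ i)"

definition coset_vertex :: "nat list \<Rightarrow> ('p::prime_card laurent \<times> int) set" where
  "coset_vertex w = (word_bar w, 0) <#\<^bsub>lamplighter\<^esub> Hsub (length w)"

text \<open>Left translation of cosets, transported to words along \<^const>\<open>coset_vertex\<close>
  (which is a bijection from words to cosets and turns one-letter extension into inclusion,
  see \<open>bij_betw_coset_vertex\<close> and \<open>coset_vertex_edge\<close> below).\<close>

definition tree_action :: "'p::prime_card laurent \<times> int \<Rightarrow> nat list \<Rightarrow> nat list" where
  "tree_action h = (\<lambda>w\<in>lists {..<CARD('p)}.
     inv_into (lists {..<CARD('p)}) coset_vertex (h <#\<^bsub>lamplighter\<^esub> coset_vertex w))"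

text \<open>\<open>wreath_recursion A f g\<close> is \<open>f = (g\<^sub>i)\<close>, indexed by \<open>i \<in> A\<close>, for an \<open>f\<close> that fixes each
  letter of the first level.\<close>

definition wreath_recursion ::
    "'l set \<Rightarrow> ('l list \<Rightarrow> 'l list) \<Rightarrow> ('l \<Rightarrow> 'l list \<Rightarrow> 'l list) \<Rightarrow> bool" where
  "wreath_recursion A f g \<longleftrightarrow>
     (\<forall>i\<in>A. f [i] = [i] \<and> (\<forall>w\<in>lists A. f (i # w) = i # g i w))"

section \<open>Automata\<close>

record ('q, 'l) mealy =
  states :: "'q set"
  alphabet :: "'l set"
  out_letter :: "'q \<Rightarrow> 'l \<Rightarrow> 'l"
  next_state :: "'q \<Rightarrow> 'l \<Rightarrow> 'q"

fun mealy_run :: "('q, 'l) mealy \<Rightarrow> 'q \<Rightarrow> 'l list \<Rightarrow> 'l list" where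
  "mealy_run M q [] = []"
| "mealy_run M q (c # w) = out_letter M q c # mealy_run M (next_state M q c) w"

definition state_map :: "('q, 'l) mealy \<Rightarrow> 'q \<Rightarrow> 'l list \<Rightarrow> 'l list" where
  "state_map M q = restrict (mealy_run M q) (lists (alphabet M))"

text \<open>\<^const>\<open>subgroup_generated\<close> silently ignores generators outside the carrier, so this is
  the intended group only if every state acts as a tree automorphism.\<close>

definition automaton_group :: "('q, 'l) mealy \<Rightarrow> ('l list \<Rightarrow> 'l list) monoid" where
  "automaton_group M = subgroup_generated (tree_aut (alphabet M)) (state_map M ` states M)"

text \<open>State \<open>i\<close> stands for \<open>a\<^sub>i\<close>.\<close>

definition lamplighter_automaton :: "nat \<Rightarrow> (nat, nat) mealy" where
  "lamplighter_automaton p = \<lparr>states = {..<p}, alphabet = {..<p},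
     out_letter = (\<lambda>i j. (j + i) mod p), next_state = (\<lambda>i j. j)\<rparr>"

section \<open>The identification of words with cosets\<close>

lemma xpow_mult: "xpow s * xpow t = xpow (s + t)"
  by (simp add: xpow_def mult_single)

lemma xpow_0 [simp]: "xpow 0 = 1"
  by (simp add: xpow_def)

lemma lamplighter_simps [simp]:
  "carrier lamplighter = UNIV"
  "(v, s) \<otimes>\<^bsub>lamplighter\<^esub> (w, t) = (v + xpow s * w, s + t)"
  "\<one>\<^bsub>lamplighter\<^esub> = (0, 0)"
  by (simp_all add: lamplighter_def)

lemma group_lamplighter: "group lamplighter"
proof (rule groupI)
  fix g h k :: "'a laurent \<times> int"
  show "(g \<otimes>\<^bsub>lamplighter\<^esub> h) \<otimes>\<^bsub>lamplighter\<^esub> k = g \<otimes>\<^bsub>lamplighter\<^esub> (h \<otimes>\<^bsub>lamplighter\<^esub> k)"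
    by (cases g; cases h; cases k) (simp add: algebra_simps flip: xpow_mult)
  have "(- (xpow (- snd g) * fst g), - snd g) \<otimes>\<^bsub>lamplighter\<^esub> g = \<one>\<^bsub>lamplighter\<^esub>"
    by (cases g) simp
  then show "\<exists>h\<in>carrier lamplighter. h \<otimes>\<^bsub>lamplighter\<^esub> g = \<one>\<^bsub>lamplighter\<^esub>"
    by auto
qed (auto simp: split_paired_all)

lemma mem_Hsub: "(v, s) \<in> Hsub m \<longleftrightarrow> (1 - xpow 1) ^ m dvd v"
  by (auto simp: Hsub_def dvd_def)

lemma subgroup_Hsub: "subgroup (Hsub m) lamplighter"
proof -
  interpret group "lamplighter :: ('a laurent \<times> int) monoid" by (rule group_lamplighter)
  show ?thesis
  proof (rule subgroupI)
    fix g :: "'a laurent \<times> int" assume g: "g \<in> Hsub m"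
    obtain v s where gs: "g = (v, s)" by (cases g)
    have "inv\<^bsub>lamplighter\<^esub> g = (- (xpow (- s) * v), - s)"
      by (rule inv_equality) (simp_all add: gs)
    then show "inv\<^bsub>lamplighter\<^esub> g \<in> Hsub m"
      using g by (simp add: gs mem_Hsub)
  next
    have "(0, 0) \<in> (Hsub m :: ('a laurent \<times> int) set)" by (simp add: mem_Hsub)
    then show "Hsub m \<noteq> ({} :: ('a laurent \<times> int) set)" by blast
  qed (auto simp: mem_Hsub)
qed

lemma xpow_dvd_cancel: "d dvd xpow s * v \<longleftrightarrow> d dvd v"
proof
  assume "d dvd xpow s * v"
  then have "d dvd xpow (- s) * (xpow s * v)" by (rule dvd_mult)
  then show "d dvd v" by (simp add: xpow_mult flip: mult.assoc)
qed simp

lemma mem_coset_Hsub: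
  "(u, t) \<in> (v, s) <#\<^bsub>lamplighter\<^esub> Hsub m \<longleftrightarrow> (1 - xpow 1) ^ m dvd u - v"
proof
  assume "(u, t) \<in> (v, s) <#\<^bsub>lamplighter\<^esub> Hsub m"
  then show "(1 - xpow 1) ^ m dvd u - v"
    by (auto simp: l_coset_def mem_Hsub)
next
  assume *: "(1 - xpow 1) ^ m dvd u - v"
  have "(u, t) = (v, s) \<otimes>\<^bsub>lamplighter\<^esub> (xpow (- s) * (u - v), t - s)"
    by (simp add: xpow_mult flip: mult.assoc)
  moreover have "(xpow (- s) * (u - v), t - s) \<in> Hsub m"
    using * by (simp add: mem_Hsub xpow_dvd_cancel)
  ultimately show "(u, t) \<in> (v, s) <#\<^bsub>lamplighter\<^esub> Hsub m"
    unfolding l_coset_def by blast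
qed

lemma one_minus_dvd_xpow: "(1 - xpow 1) dvd (xpow s - 1)"
proof (induction s rule: int_induct[where k = 0])
  case (step1 i)
  have "xpow (i + 1) - 1 = (xpow i - 1) - (1 - xpow 1) * xpow i"
    by (simp add: algebra_simps xpow_mult)
  then show ?case using step1.IH by (metis dvd_diff dvd_triv_left)
next
  case (step2 i)
  have "xpow (i - 1) - 1 = (xpow i - 1) + (1 - xpow 1) * xpow (i - 1)"
    by (simp add: algebra_simps xpow_mult)
  then show ?case using step2.IH by (metis dvd_add dvd_triv_left)
qed simp

text \<open>The augmentation, i.e. evaluation at \<open>x = 1\<close>.\<close>

definition aug :: "'p::prime_card laurent \<Rightarrow> 'p mod_ring" where
  "aug v = (\<Sum>k\<in>Poly_Mapping.keys v. Poly_Mapping.lookup v k)"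

lemma aug_superset: "finite K \<Longrightarrow> Poly_Mapping.keys v \<subseteq> K \<Longrightarrow> aug v = (\<Sum>k\<in>K. Poly_Mapping.lookup v k)"
  unfolding aug_def by (rule sum.mono_neutral_left) (auto simp: in_keys_iff)

lemma aug_add: "aug (v + w) = aug v + aug w"
proof -
  have "Poly_Mapping.keys (v + w) \<subseteq> Poly_Mapping.keys v \<union> Poly_Mapping.keys w" by (rule Poly_Mapping.keys_add)
  then show ?thesis
    by (simp add: aug_superset[of "Poly_Mapping.keys v \<union> Poly_Mapping.keys w"] lookup_add sum.distrib)
qed

lemma aug_diff: "aug (v - w) = aug v - aug w"
  using aug_add[of "v - w" w] by simp

lemma aug_single [simp]: "aug (Poly_Mapping.single k c) = c"
  by (simp add: aug_def)

lemma aug_xpow_mult: "aug (xpow s * v) = aug v"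
proof (induction v rule: update_induct)
  case const
  then show ?case by simp
next
  case (update f a b)
  have "Poly_Mapping.update a b f = Poly_Mapping.single a b + f"
    using update.hyps
    by (intro poly_mapping_eqI)
      (auto simp: lookup_update lookup_add lookup_single in_keys_iff when_def)
  then show ?case
    using update.IH by (simp add: xpow_def distrib_left aug_add mult_single)
qed

lemma aug_decomp: "1 - xpow 1 dvd v - Poly_Mapping.single 0 (aug v)"
proof (induction v rule: update_induct)
  case const
  then show ?case by (simp add: aug_def)
next
  case (update f a b)
  have "Poly_Mapping.update a b f = Poly_Mapping.single a b + f"
    using update.hyps
    by (intro poly_mapping_eqI)
      (auto simp: lookup_update lookup_add lookup_single in_keys_iff when_def)
  moreover have "Poly_Mapping.single a b + f - Poly_Mapping.single 0 (aug (Poly_Mapping.single a b + f))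
      = Poly_Mapping.single 0 b * (xpow a - 1) + (f - Poly_Mapping.single 0 (aug f))"
    by (simp add: aug_add single_add xpow_def right_diff_distrib mult_single)
  moreover have "1 - xpow 1 dvd Poly_Mapping.single 0 b * (xpow a - 1)"
    using one_minus_dvd_xpow by (rule dvd_mult)
  ultimately show ?case
    using update.IH by (simp only: dvd_add)
qed

lemma one_minus_dvd_iff: "1 - xpow 1 dvd v \<longleftrightarrow> aug v = 0"
proof
  assume "1 - xpow 1 dvd v"
  then obtain r where "v = (1 - xpow 1) * r" by (auto simp: dvd_def)
  then show "aug v = 0" by (simp add: left_diff_distrib aug_diff aug_xpow_mult)
next
  assume "aug v = 0"
  then show "1 - xpow 1 dvd v" using aug_decomp[of v] by simp
qed

lemma xpow_1_neq_1: "xpow 1 \<noteq> (1 :: 'p::prime_card laurent)"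
proof
  assume "xpow 1 = (1 :: 'p laurent)"
  then have "Poly_Mapping.lookup (xpow 1 :: 'p laurent) 1 = Poly_Mapping.lookup (1 :: 'p laurent) 1"
    by (rule arg_cong)
  then show False by (simp add: xpow_def lookup_single lookup_one)
qed

lemma word_bar_Nil [simp]: "word_bar [] = 0"
  by (simp add: word_bar_def)

lemma word_bar_Cons: "word_bar (c # w) = of_nat c + (xpow 1 - 1) * word_bar w"
proof -
  have "word_bar (c # w)
      = (\<Sum>i<Suc (length w). of_nat ((c # w) ! i) * (xpow 1 - 1) ^ i)"
    by (simp add: word_bar_def)
  also have "\<dots> = of_nat c + (xpow 1 - 1) * word_bar w"
    by (subst sum.lessThan_Suc_shift)
      (simp add: word_bar_def sum_distrib_left algebra_simps)
  finally show ?thesis .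
qed

lemma aug_of_nat: "aug (of_nat n) = of_nat n"
  by (metis aug_single single_of_nat)

lemma aug_word_bar_Cons: "aug (word_bar (c # w)) = of_nat c"
  by (simp add: word_bar_Cons aug_add left_diff_distrib aug_diff aug_xpow_mult aug_of_nat)

lemma of_nat_mod_ring_inj:
  assumes "c < CARD('p)" "d < CARD('p)" "of_nat c = (of_nat d :: 'p::prime_card mod_ring)"
  shows "c = d"
  using assms
  by (metis mod_less of_int_of_nat_eq of_int_of_int_mod_ring of_nat_less_iff of_nat_0_le_iff
      to_int_mod_ring_of_int_mod_ring of_nat_eq_iff)

lemma word_bar_exists:
  "\<exists>w\<in>lists {..<CARD('p)}. length w = m \<and> (1 - xpow 1) ^ m dvd (v :: 'p::prime_card laurent) - word_bar w"
proof (induction m arbitrary: v)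
  case 0
  show ?case by (intro bexI[of _ "[]"]) auto
next
  case (Suc m)
  obtain c where c: "c < CARD('p)" "aug v = of_nat c"
    using surj_of_nat_mod_ring by metis
  then have "1 - xpow 1 dvd v - of_nat c"
    by (simp add: one_minus_dvd_iff aug_diff aug_of_nat)
  then obtain r where r: "v - of_nat c = (1 - xpow 1) * r" by (auto simp: dvd_def)
  obtain w where w: "w \<in> lists {..<CARD('p)}" "length w = m"
      "(1 - xpow 1) ^ m dvd (- r) - word_bar w"
    using Suc.IH by blast
  have "v - word_bar (c # w) = (1 - xpow 1) * - ((- r) - word_bar w)"
    using r by (simp add: word_bar_Cons algebra_simps)
  moreover have "(1 - xpow 1) ^ m dvd - ((- r) - word_bar w)"
    using w(3) by (simp only: dvd_minus_iff)
  ultimately have "(1 - xpow 1) ^ Suc m dvd v - word_bar (c # w)"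
    by (simp only: power_Suc mult_dvd_mono[OF dvd_refl])
  then show ?case
    using w c by (intro bexI[of _ "c # w"]) auto
qed

lemma word_bar_unique:
  assumes "w \<in> lists {..<CARD('p)}" "w' \<in> lists {..<CARD('p)}"
    and "length w = m" "length w' = m"
    and "(1 - xpow 1) ^ m dvd word_bar w - (word_bar w' :: 'p::prime_card laurent)"
  shows "w = w'"
  using assms
proof (induction m arbitrary: w w')
  case 0
  then show ?case by simp
next
  case (Suc m)
  obtain c u where w: "w = c # u" using Suc.prems(3) by (cases w) auto
  obtain d u' where w': "w' = d # u'" using Suc.prems(4) by (cases w') auto
  have dvd: "(1 - xpow 1) ^ Suc m dvd word_bar (c # u) - (word_bar (d # u') :: 'p laurent)"
    using Suc.prems(5) by (simp only: w w')
  then have "1 - xpow 1 dvd word_bar (c # u) - (word_bar (d # u') :: 'p laurent)"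
    by (metis dvd_mult_left power_Suc)
  then have "of_nat c = (of_nat d :: 'p mod_ring)"
    by (simp add: one_minus_dvd_iff aug_diff aug_word_bar_Cons)
  then have cd: "c = d"
    using Suc.prems(1,2) by (intro of_nat_mod_ring_inj[where 'p='p]) (auto simp: w w')
  have "word_bar (c # u) - word_bar (d # u')
      = (1 - xpow 1) * - (word_bar u - (word_bar u' :: 'p laurent))"
    by (simp add: cd word_bar_Cons algebra_simps)
  with dvd have "(1 - xpow 1) * (1 - xpow 1) ^ m
      dvd (1 - xpow 1) * - (word_bar u - (word_bar u' :: 'p laurent))"
    by simp
  then have "(1 - xpow 1) ^ m dvd - (word_bar u - (word_bar u' :: 'p laurent))"
    using xpow_1_neq_1[where 'p='p] by (subst (asm) dvd_mult_cancel_left) auto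
  then have "(1 - xpow 1) ^ m dvd word_bar u - (word_bar u' :: 'p laurent)"
    by (simp only: dvd_minus_iff)
  then have "u = u'"
    using Suc.prems by (intro Suc.IH) (auto simp: w w')
  then show ?case by (simp add: w w' cd)
qed

lemma dvd_diff_shift:
  fixes d :: "'a::comm_ring_1"
  assumes "d dvd v - w"
  shows "d dvd u - v \<longleftrightarrow> d dvd u - w"
proof
  assume "d dvd u - v"
  from dvd_add[OF this assms] show "d dvd u - w" by simp
next
  assume "d dvd u - w"
  from dvd_diff[OF this assms] show "d dvd u - v" by simp
qed

lemma mem_coset_vertex:
  "(v, s) \<in> coset_vertex w \<longleftrightarrow> (1 - xpow 1) ^ length w dvd v - word_bar w"
  by (simp add: coset_vertex_def mem_coset_Hsub)

lemma one_minus_power_dvd_iff: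
  "(1 - xpow 1) ^ m dvd ((1 - xpow 1) ^ n :: 'p::prime_card laurent) \<longleftrightarrow> m \<le> n"
proof
  assume dvd: "(1 - xpow 1) ^ m dvd ((1 - xpow 1) ^ n :: 'p laurent)"
  have ndvd: "\<not> (1 - xpow 1) dvd (1 :: 'p laurent)"
    using aug_single[of 0 "1 :: 'p mod_ring"] by (simp add: one_minus_dvd_iff)
  show "m \<le> n"
  proof (rule ccontr)
    assume "\<not> m \<le> n"
    then have "(1 - xpow 1) ^ Suc n dvd ((1 - xpow 1) ^ n :: 'p laurent)"
      using dvd by (meson dvd_trans le_imp_power_dvd not_less_eq_eq)
    then have "(1 - xpow 1) ^ n * (1 - xpow 1) dvd (1 - xpow 1) ^ n * (1 :: 'p laurent)"
      by (simp add: mult.commute)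
    then have "1 - xpow 1 dvd (1 :: 'p laurent)"
      using xpow_1_neq_1[where 'p='p] by (subst (asm) dvd_mult_cancel_left) auto
    then show False using ndvd by blast
  qed
qed (rule le_imp_power_dvd)

lemma coset_vertex_subset_iff:
  assumes "w \<in> lists {..<CARD('p)}" "w' \<in> lists {..<CARD('p)}"
  shows "coset_vertex w' \<subseteq> (coset_vertex w :: ('p::prime_card laurent \<times> int) set)
    \<longleftrightarrow> (\<exists>u. w' = w @ u)"
proof -
  let ?y = "1 - xpow 1 :: 'p laurent"
  have bar_append: "word_bar (w1 @ u) = word_bar w1 + (xpow 1 - 1) ^ length w1 * (word_bar u :: 'p laurent)"
    for w1 u
    by (induction w1) (simp_all add: word_bar_Cons algebra_simps)
  have y: "?y ^ n dvd (xpow 1 - 1) ^ n * r" for n r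
  proof -
    have "(xpow 1 - 1 :: 'p laurent) = - ?y" by simp
    then have "?y dvd xpow 1 - 1" by (metis dvd_minus_iff dvd_refl)
    then show ?thesis by (intro dvd_mult2 dvd_power_same)
  qed
  show ?thesis
  proof
    assume "\<exists>u. w' = w @ u"
    then obtain u where u: "w' = w @ u" by blast
    show "coset_vertex w' \<subseteq> (coset_vertex w :: ('p laurent \<times> int) set)"
    proof
      fix g :: "'p laurent \<times> int" assume g: "g \<in> coset_vertex w'"
      obtain v s where vs: "g = (v, s)" by (cases g)
      have "?y ^ length w dvd v - word_bar w'"
        using g u by (auto simp: vs mem_coset_vertex power_add intro: dvd_mult_left)
      then have "?y ^ length w dvd (v - word_bar w') + (xpow 1 - 1) ^ length w * word_bar u"
        using y by (rule dvd_add)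
      then show "g \<in> coset_vertex w"
        by (simp add: vs mem_coset_vertex u bar_append)
    qed
  next
    assume sub: "coset_vertex w' \<subseteq> (coset_vertex w :: ('p laurent \<times> int) set)"
    have "(word_bar w' :: 'p laurent, 0) \<in> coset_vertex w'"
      and "(word_bar w' + ?y ^ length w', 0) \<in> coset_vertex w'"
      by (simp_all add: mem_coset_vertex)
    then have 1: "?y ^ length w dvd word_bar w' - word_bar w"
      and 2: "?y ^ length w dvd word_bar w' + ?y ^ length w' - word_bar w"
      unfolding mem_coset_vertex[symmetric, where s = 0] using sub by blast+
    from dvd_diff[OF 2 1] have "?y ^ length w dvd ?y ^ length w'"
      by (simp add: algebra_simps)
    then have le: "length w \<le> length w'" by (simp only: one_minus_power_dvd_iff)
    let ?w1 = "take (length w) w'" and ?u = "drop (length w) w'"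
    have len: "length ?w1 = length w" using le by simp
    have "word_bar w' = word_bar ?w1 + (xpow 1 - 1) ^ length w * (word_bar ?u :: 'p laurent)"
      using bar_append[of ?w1 ?u] by (simp only: len append_take_drop_id)
    then have "word_bar ?w1 - word_bar w
        = (word_bar w' - word_bar w) - (xpow 1 - 1) ^ length w * (word_bar ?u :: 'p laurent)"
      by simp
    then have "?y ^ length w dvd word_bar ?w1 - word_bar w"
      using dvd_diff[OF 1 y[of "length w" "word_bar ?u"]] by (simp only:)
    then have "?w1 = w"
      using assms len by (intro word_bar_unique[where 'p='p]) (auto dest: in_set_takeD)
    then show "\<exists>u. w' = w @ u" by (metis append_take_drop_id)
  qed
qed

lemma bij_betw_coset_vertex:
  "bij_betw coset_vertex (lists {..<CARD('p)})
     (\<Union>m. lcosets\<^bsub>lamplighter\<^esub> (Hsub m :: ('p::prime_card laurent \<times> int) set))"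
  unfolding bij_betw_def
proof
  show "inj_on (coset_vertex :: _ \<Rightarrow> ('p laurent \<times> int) set) (lists {..<CARD('p)})"
  proof (rule inj_onI)
    fix w w' assume w: "w \<in> lists {..<CARD('p)}" "w' \<in> lists {..<CARD('p)}"
      and eq: "coset_vertex w = (coset_vertex w' :: ('p laurent \<times> int) set)"
    have "\<exists>u. w' = w @ u" "\<exists>u. w = w' @ u"
      using coset_vertex_subset_iff[where 'p='p] w eq by blast+
    then show "w = w'" by auto
  qed
  show "(coset_vertex :: _ \<Rightarrow> ('p laurent \<times> int) set) ` lists {..<CARD('p)}
      = (\<Union>m. lcosets\<^bsub>lamplighter\<^esub> Hsub m)"
  proof
    show "(coset_vertex :: _ \<Rightarrow> ('p laurent \<times> int) set) ` lists {..<CARD('p)}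
        \<subseteq> (\<Union>m. lcosets\<^bsub>lamplighter\<^esub> Hsub m)"
      by (auto simp: coset_vertex_def LCOSETS_def)
  next
    show "(\<Union>m. lcosets\<^bsub>lamplighter\<^esub> Hsub m)
        \<subseteq> (coset_vertex :: _ \<Rightarrow> ('p laurent \<times> int) set) ` lists {..<CARD('p)}"
    proof
      fix C :: "('p laurent \<times> int) set" assume "C \<in> (\<Union>m. lcosets\<^bsub>lamplighter\<^esub> Hsub m)"
      then obtain m v s where C: "C = (v, s) <#\<^bsub>lamplighter\<^esub> Hsub m"
        by (auto simp: LCOSETS_def)
      obtain w where w: "w \<in> lists {..<CARD('p)}" "length w = m"
          "(1 - xpow 1) ^ m dvd v - word_bar w"
        using word_bar_exists by blast
      have "(u, t) \<in> C \<longleftrightarrow> (u, t) \<in> coset_vertex w" for u t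
        unfolding C mem_coset_Hsub mem_coset_vertex w(2)
        using w(3) by (rule dvd_diff_shift)
      then have "C = coset_vertex w" by auto
      then show "C \<in> coset_vertex ` lists {..<CARD('p)}" using w(1) by blast
    qed
  qed
qed

lemma coset_vertex_edge:
  assumes "w \<in> lists {..<CARD('p)}" "w' \<in> lists {..<CARD('p)}"
  shows "(\<exists>c. w' = w @ [c]) \<longleftrightarrow> length w' = Suc (length w) \<and>
    coset_vertex w' \<subseteq> (coset_vertex w :: ('p::prime_card laurent \<times> int) set)"
  unfolding coset_vertex_subset_iff[where 'p='p, OF assms]
proof
  assume *: "length w' = Suc (length w) \<and> (\<exists>u. w' = w @ u)"
  then obtain u where u: "w' = w @ u" by blast
  then have "length u = Suc 0" using * by simp
  then show "\<exists>c. w' = w @ [c]" using u by (auto simp: length_Suc_conv)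
qed auto

lemma tree_action:
  assumes "w \<in> lists {..<CARD('p)}"
  shows "tree_action h w \<in> lists {..<CARD('p)}"
    and "coset_vertex (tree_action (h :: 'p::prime_card laurent \<times> int) w)
      = h <#\<^bsub>lamplighter\<^esub> coset_vertex w"
    and "length (tree_action h w) = length w"
proof -
  interpret group "lamplighter :: ('p laurent \<times> int) monoid" by (rule group_lamplighter)
  obtain v s where h: "h = (v, s)" by (cases h)
  have translate: "h <#\<^bsub>lamplighter\<^esub> coset_vertex w
      = (v + xpow s * word_bar w, s) <#\<^bsub>lamplighter\<^esub> Hsub (length w)"
    by (simp add: h coset_vertex_def lcos_m_assoc)
  obtain w' where w': "w' \<in> lists {..<CARD('p)}" "length w' = length w"
      "(1 - xpow 1) ^ length w dvd (v + xpow s * word_bar w) - word_bar w'"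
    using word_bar_exists by blast
  have "(u, t) \<in> h <#\<^bsub>lamplighter\<^esub> coset_vertex w \<longleftrightarrow> (u, t) \<in> coset_vertex w'" for u t
    unfolding translate mem_coset_Hsub mem_coset_vertex w'(2)
    using w'(3) by (rule dvd_diff_shift)
  then have eq: "h <#\<^bsub>lamplighter\<^esub> coset_vertex w = coset_vertex w'" by auto
  have "tree_action h w = w'"
    using assms w'(1) bij_betw_coset_vertex[where 'p='p]
    by (simp add: tree_action_def eq bij_betw_def inv_into_f_f)
  then show "tree_action h w \<in> lists {..<CARD('p)}"
    and "coset_vertex (tree_action h w) = h <#\<^bsub>lamplighter\<^esub> coset_vertex w"
    and "length (tree_action h w) = length w"
    using w' eq by simp_all
qed

end

theory Submission
  imports Defs
begin

text \<open>Put \<open>y = x - 1\<close>, so that a word lists the first digits of a \<open>y\<close>-adic expansion.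
  Adding \<open>i\<close> changes only the digit of \<open>y ^ 0\<close>, and multiplying by \<open>x = 1 + y\<close> adds to each digit
  the previous one, without carries because the characteristic is \<open>p\<close>; this is the automaton.
  The action is faithful since only \<open>0\<close> is divisible by all powers of \<open>y\<close>.\<close>

section \<open>Laurent polynomials: characteristic, coefficients, and divisibility by powers of
  \<open>1 - x\<close>\<close>

text \<open>Turns the step of \<open>update_induct\<close> into the addition of one
  monomial.\<close>

lemma update_eq_single_add:
  fixes f :: "'a \<Rightarrow>\<^sub>0 'b::monoid_add"
  assumes "k \<notin> Poly_Mapping.keys f"
  shows "Poly_Mapping.update k c f = Poly_Mapping.single k c + f"
  using assms
  by (intro poly_mapping_eqI)
    (auto simp: lookup_update lookup_add lookup_single in_keys_iff when_def)

text \<open>This is why no carries occur: a digit may be reduced modulo \<open>p\<close> without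
  changing the Laurent polynomial it stands for.\<close>

lemma of_nat_mod_laurent: "of_nat (n mod CARD('p)) = (of_nat n :: 'p::prime_card laurent)"
proof -
  have "(of_nat n :: 'p mod_ring)
      = of_nat (n mod CARD('p)) + of_nat (n div CARD('p)) * of_nat CARD('p)"
    by (metis mod_mult_div_eq mult.commute of_nat_add of_nat_mult)
  then have "of_nat (n mod CARD('p)) = (of_nat n :: 'p mod_ring)" by simp
  then show ?thesis by (metis single_of_nat)
qed

lemma lookup_xpow_mult: "Poly_Mapping.lookup (xpow s * v) k = Poly_Mapping.lookup v (k - s)"
proof (induction v rule: update_induct)
  case const
  then show ?case by simp
next
  case (update f a b)
  have "Poly_Mapping.update a b f = Poly_Mapping.single a b + f"
    using update.hyps(1) by (rule update_eq_single_add)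
  moreover have "(s + a = k) = (a = k - s)" by auto
  ultimately show ?case
    using update.IH
    by (simp add: xpow_def distrib_left mult_single lookup_add lookup_single)
qed

text \<open>Each factor \<open>1 - x\<close> subtracts a copy shifted by one place to the right, so
  the lowest coefficient survives unchanged and the highest one reappears, negated, one place
  further.\<close>

lemma lookup_one_minus_power_mult:
  fixes r :: "'p::prime_card laurent"
  assumes "Poly_Mapping.lookup r i \<noteq> 0" "\<And>k. k < i \<Longrightarrow> Poly_Mapping.lookup r k = 0"
    and "Poly_Mapping.lookup r j \<noteq> 0" "\<And>k. k > j \<Longrightarrow> Poly_Mapping.lookup r k = 0"
  defines "u \<equiv> \<lambda>m. (1 - xpow 1) ^ m * r"
  shows "Poly_Mapping.lookup (u m) i \<noteq> 0 \<and> (\<forall>k<i. Poly_Mapping.lookup (u m) k = 0)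
    \<and> Poly_Mapping.lookup (u m) (j + int m) \<noteq> 0
    \<and> (\<forall>k>j + int m. Poly_Mapping.lookup (u m) k = 0)"
proof (induction m)
  case 0
  then show ?case using assms by (auto simp: u_def)
next
  case (Suc m)
  have "u (Suc m) = u m - xpow 1 * u m" by (simp add: u_def algebra_simps)
  then have "Poly_Mapping.lookup (u (Suc m)) k
      = Poly_Mapping.lookup (u m) k - Poly_Mapping.lookup (u m) (k - 1)" for k
    by (simp add: lookup_minus lookup_xpow_mult)
  then show ?case using Suc.IH by auto
qed

text \<open>Multiplication by \<open>(1 - x) ^ m\<close> widens the support of a nonzero Laurent polynomial by \<open>m\<close>.\<close>

lemma eq_0_if_one_minus_powers_dvd:
  fixes v :: "'p::prime_card laurent"
  assumes "\<And>m. (1 - xpow 1) ^ m dvd v"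
  shows "v = 0"
proof (rule ccontr)
  assume v: "v \<noteq> 0"
  let ?K = "Poly_Mapping.keys v"
  \<comment> \<open>Exceeds the distance between the ends of the support of \<open>v\<close>,
    whereas a nonzero multiple of \<open>(1 - x) ^ m\<close> has ends at least \<open>m\<close>
    apart.\<close>
  define m where "m = Suc (nat (Max ?K - Min ?K))"
  obtain r where r: "v = (1 - xpow 1) ^ m * r" using assms by (auto simp: dvd_def)
  define L where "L = Poly_Mapping.keys r"
  have "r \<noteq> 0" using v r by auto
  then have L: "finite L" "L \<noteq> {}" by (auto simp: L_def)
  have "Poly_Mapping.lookup r (Min L) \<noteq> 0" "Poly_Mapping.lookup r (Max L) \<noteq> 0"
    using Min_in[OF L] Max_in[OF L] by (auto simp: L_def in_keys_iff)
  moreover have "Poly_Mapping.lookup r k = 0" if "k < Min L" for k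
    using that L Min_le[of L k] by (force simp: L_def in_keys_iff)
  moreover have "Poly_Mapping.lookup r k = 0" if "k > Max L" for k
    using that L Max_ge[of L k] by (force simp: L_def in_keys_iff)
  ultimately have "Min L \<in> ?K" "Max L + int m \<in> ?K"
    unfolding r in_keys_iff by (auto dest: lookup_one_minus_power_mult[of r "Min L" "Max L" m])
  then have "Min ?K \<le> Min L" "Max L + int m \<le> Max ?K" by auto
  moreover have "Min L \<le> Max L" using L by simp
  ultimately show False unfolding m_def by linarith
qed

section \<open>The action on words, computed by divisibility\<close>

text \<open>The representative \<open>(word_bar w, 0)\<close> of the coset is translated to
  \<open>(v + xpow s * word_bar w, s)\<close>, which must lie in the image coset.\<close>

lemma tree_action_dvd:
  fixes v :: "'p::prime_card laurent"
  assumes "w \<in> lists {..<CARD('p)}"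
  shows "(1 - xpow 1) ^ length w dvd v + xpow s * word_bar w - word_bar (tree_action (v, s) w)"
proof -
  have "(word_bar w, 0) \<in> (coset_vertex w :: ('p laurent \<times> int) set)"
    by (simp add: mem_coset_vertex)
  then have "(v, s) \<otimes>\<^bsub>lamplighter\<^esub> (word_bar w, 0) \<in> (v, s) <#\<^bsub>lamplighter\<^esub> coset_vertex w"
    unfolding l_coset_def by blast
  then have "(v + xpow s * word_bar w, s) \<in> coset_vertex (tree_action (v, s) w)"
    by (simp add: tree_action(2)[OF assms])
  then show ?thesis by (simp add: mem_coset_vertex tree_action(3)[OF assms])
qed

text \<open>A word of known length is determined by its residue, so explicit values of the action
  reduce to a divisibility check.\<close>

lemma tree_action_eqI:
  fixes v :: "'p::prime_card laurent"
  assumes "w \<in> lists {..<CARD('p)}" "u \<in> lists {..<CARD('p)}" "length u = length w"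
    and "(1 - xpow 1) ^ length w dvd v + xpow s * word_bar w - word_bar u"
  shows "tree_action (v, s) w = u"
proof (rule word_bar_unique[where 'p = 'p])
  show "(1 - xpow 1) ^ length w dvd
      word_bar (tree_action (v, s) w) - (word_bar u :: 'p laurent)"
    using dvd_diff[OF assms(4) tree_action_dvd[OF assms(1), of v s]] by simp
qed (use assms tree_action[where 'p = 'p] in auto)

text \<open>Here the difference of the two expansions is exactly \<open>0\<close>, not merely
  divisible.\<close>

lemma tree_action_translation:
  assumes "c < CARD('p)" "w \<in> lists {..<CARD('p)}"
  shows "tree_action (of_nat i :: 'p::prime_card laurent, 0) (c # w) = ((c + i) mod CARD('p)) # w"
  using assms
  by (intro tree_action_eqI) (simp_all add: word_bar_Cons of_nat_mod_laurent)

text \<open>With \<open>y = x - 1\<close>, this is \<open>i + x (c + y w) = (i + c) + y (c + x w)\<close>.\<close>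

lemma tree_action_Cons:
  assumes c: "c < CARD('p)" and w: "w \<in> lists {..<CARD('p)}"
  shows "tree_action (of_nat i :: 'p::prime_card laurent, 1) (c # w)
    = ((c + i) mod CARD('p)) # tree_action (of_nat c :: 'p laurent, 1) w"
proof (rule tree_action_eqI)
  let ?u = "tree_action (of_nat c :: 'p laurent, 1) w"
  \<comment> \<open>The sign appears because divisibility is stated for \<open>1 - x\<close> while
    digits belong to powers of \<open>x - 1\<close>.\<close>
  have "of_nat i + xpow 1 * word_bar (c # w) - word_bar (((c + i) mod CARD('p)) # ?u)
      = (1 - xpow 1) * - (of_nat c + xpow 1 * word_bar w - (word_bar ?u :: 'p laurent))"
    by (simp add: word_bar_Cons of_nat_mod_laurent algebra_simps)
  moreover have "(1 - xpow 1) ^ length w dvd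
      - (of_nat c + xpow 1 * word_bar w - (word_bar ?u :: 'p laurent))"
    using tree_action_dvd[OF w] by (simp only: dvd_minus_iff)
  ultimately show "(1 - xpow 1) ^ length (c # w) dvd of_nat i + xpow 1 * word_bar (c # w)
      - (word_bar (((c + i) mod CARD('p)) # ?u) :: 'p laurent)"
    by (simp only: length_Cons power_Suc mult_dvd_mono[OF dvd_refl])
qed (use c w tree_action[where 'p = 'p, OF w] in auto)

lemma tree_action_Nil: "tree_action (h :: 'p::prime_card laurent \<times> int) [] = []"
  using tree_action(3)[of "[]" h] by simp

section \<open>The automaton and its states\<close>

text \<open>The recursion \<open>tree_action_Cons\<close> is the transition rule itself; the start
  state must vary in the induction, since after reading \<open>c\<close> the state is
  \<open>c\<close>.\<close>

lemma mealy_run_lamplighter_automaton: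
  assumes "w \<in> lists {..<CARD('p)}"
  shows "mealy_run (lamplighter_automaton CARD('p)) i w
    = tree_action (of_nat i :: 'p::prime_card laurent, 1) w"
  using assms
proof (induction w arbitrary: i)
  case (Cons c w)
  \<comment> \<open>The automaton is unfolded only in the second call, because the induction
    hypothesis mentions it folded.\<close>
  then show ?case by (simp add: tree_action_Cons) (simp add: lamplighter_automaton_def)
qed (simp add: tree_action_Nil)

text \<open>Equality of functions, not only on words: both sides are \<open>undefined\<close> off
  the alphabet.\<close>

lemma state_map_lamplighter_automaton:
  "state_map (lamplighter_automaton CARD('p)) i
    = tree_action (of_nat i :: 'p::prime_card laurent, 1)"
proof
  fix w
  have "alphabet (lamplighter_automaton CARD('p)) = {..<CARD('p)}"
    by (simp add: lamplighter_automaton_def)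
  then show "state_map (lamplighter_automaton CARD('p)) i w
      = tree_action (of_nat i :: 'p laurent, 1) w"
    by (cases "w \<in> lists {..<CARD('p)}")
      (simp_all only: state_map_def mealy_run_lamplighter_automaton restrict_apply if_True if_False,
       simp add: tree_action_def)
qed

text \<open>The state always equals the letter just read, so \<open>i\<close> acts as a letter
  preceding the word.\<close>

lemma mealy_run_lamplighter_automaton_nth:
  "mealy_run (lamplighter_automaton p) i w
    = map (\<lambda>k. (w ! k + (if k = 0 then i else w ! (k - 1))) mod p) [0..<length w]"
proof (induction w arbitrary: i)
  case (Cons c w)
  have "mealy_run (lamplighter_automaton p) i (c # w)
      = ((c + i) mod p) # mealy_run (lamplighter_automaton p) c w"
    by (simp add: lamplighter_automaton_def)
  also have "\<dots> = map (\<lambda>k. ((c # w) ! k + (if k = 0 then i else (c # w) ! (k - 1))) mod p)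
      (0 # map Suc [0..<length w])"
    by (auto simp: Cons.IH nth_Cons')
  also have "0 # map Suc [0..<length w] = [0..<length (c # w)]"
    by (simp add: map_Suc_upt upt_conv_Cons del: upt_Suc)
  finally show ?case .
qed simp

section \<open>The action as a homomorphism into the tree automorphisms\<close>

text \<open>Left translations of cosets compose, and distinct words name distinct cosets.\<close>

lemma tree_action_mult:
  fixes g h :: "'p::prime_card laurent \<times> int"
  assumes w: "w \<in> lists {..<CARD('p)}"
  shows "tree_action (g \<otimes>\<^bsub>lamplighter\<^esub> h) w = tree_action g (tree_action h w)"
proof -
  interpret group "lamplighter :: ('p laurent \<times> int) monoid" by (rule group_lamplighter)
  have "coset_vertex (tree_action (g \<otimes>\<^bsub>lamplighter\<^esub> h) w)
      = (coset_vertex (tree_action g (tree_action h w)) :: ('p laurent \<times> int) set)"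
    using w by (simp add: tree_action lcos_m_assoc)
  moreover have "inj_on (coset_vertex :: _ \<Rightarrow> ('p laurent \<times> int) set) (lists {..<CARD('p)})"
    using bij_betw_coset_vertex by (rule bij_betw_imp_inj_on)
  ultimately show ?thesis
    using w by (meson inj_onD tree_action(1))
qed

lemma tree_action_one:
  assumes "w \<in> lists {..<CARD('p)}"
  shows "tree_action \<one>\<^bsub>lamplighter :: ('p::prime_card laurent \<times> int) monoid\<^esub> w = w"
  using assms by (simp add: tree_action_eqI)

text \<open>Left translation preserves inclusion of cosets, and inclusion between consecutive levels
  is one-letter extension.\<close>

lemma tree_action_extension:
  fixes h :: "'p::prime_card laurent \<times> int"
  assumes "u \<in> lists {..<CARD('p)}" "v \<in> lists {..<CARD('p)}" and v: "v = u @ [c]"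
  shows "\<exists>d. tree_action h v = tree_action h u @ [d]"
proof -
  have "coset_vertex v \<subseteq> (coset_vertex u :: ('p laurent \<times> int) set)"
    using coset_vertex_subset_iff assms by blast
  then have "h <#\<^bsub>lamplighter\<^esub> coset_vertex v \<subseteq> h <#\<^bsub>lamplighter\<^esub> coset_vertex u"
    by (auto simp: l_coset_def)
  then have "coset_vertex (tree_action h v) \<subseteq> (coset_vertex (tree_action h u) :: ('p laurent \<times> int) set)"
    using assms(1,2) by (simp add: tree_action)
  then show ?thesis
    using assms tree_action[where h = h]
    by (subst coset_vertex_edge[where 'p = 'p]) auto
qed

lemma tree_action_edge:
  fixes h :: "'p::prime_card laurent \<times> int"
  assumes "u \<in> lists {..<CARD('p)}" "v \<in> lists {..<CARD('p)}" "tree_edge u v"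
  shows "tree_edge (tree_action h u) (tree_action h v)"
  using assms tree_action_extension[of _ _ _ h] unfolding tree_edge_def by metis

lemma tree_action_inv:
  fixes h :: "'p::prime_card laurent \<times> int"
  assumes "w \<in> lists {..<CARD('p)}"
  shows "tree_action h (tree_action (inv\<^bsub>lamplighter\<^esub> h) w) = w"
    and "tree_action (inv\<^bsub>lamplighter\<^esub> h) (tree_action h w) = w"
proof -
  interpret group "lamplighter :: ('p laurent \<times> int) monoid" by (rule group_lamplighter)
  show "tree_action h (tree_action (inv\<^bsub>lamplighter\<^esub> h) w) = w"
    using tree_action_mult[OF assms, of h "inv\<^bsub>lamplighter\<^esub> h"] tree_action_one[OF assms]
    by (metis UNIV_I lamplighter_simps(1) r_inv)
  show "tree_action (inv\<^bsub>lamplighter\<^esub> h) (tree_action h w) = w"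
    using tree_action_mult[OF assms, of "inv\<^bsub>lamplighter\<^esub> h" h] tree_action_one[OF assms]
    by (metis UNIV_I lamplighter_simps(1) l_inv)
qed

lemma tree_action_in_Bij:
  "tree_action (h :: 'p::prime_card laurent \<times> int) \<in> Bij (lists {..<CARD('p)})"
proof -
  have "bij_betw (tree_action h) (lists {..<CARD('p)}) (lists {..<CARD('p)})"
    by (rule bij_betw_byWitness[where f' = "tree_action (inv\<^bsub>lamplighter\<^esub> h)"])
      (use tree_action_inv[where h = h] tree_action(1)[where 'p = 'p] in blast)+
  then show ?thesis by (simp add: Bij_def tree_action_def)
qed

text \<open>Edges are also reflected, because the inverse element preserves them.\<close>

lemma tree_action_in_tree_aut:
  "tree_action (h :: 'p::prime_card laurent \<times> int) \<in> carrier (tree_aut {..<CARD('p)})"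
proof -
  have "tree_edge (tree_action h u) (tree_action h v) \<longleftrightarrow> tree_edge u v"
    if "u \<in> lists {..<CARD('p)}" "v \<in> lists {..<CARD('p)}" for u v
    using tree_action_edge[OF that, of h]
      tree_action_edge[of "tree_action h u" "tree_action h v" "inv\<^bsub>lamplighter\<^esub> h"]
    by (metis that tree_action(1) tree_action_inv(2))
  then show ?thesis
    by (simp add: tree_aut_def tree_action_in_Bij tree_action_Nil)
qed

lemma group_tree_aut: "group (tree_aut A)"
proof -
  let ?S = "lists A" and ?H = "carrier (tree_aut A)"
  interpret B: group "BijGroup ?S" by (rule group_BijGroup)
  have "subgroup ?H (BijGroup ?S)"
  proof (rule B.subgroupI)
    show "?H \<subseteq> carrier (BijGroup ?S)" by (auto simp: tree_aut_def BijGroup_def)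
    have "(\<lambda>x\<in>?S. x) \<in> ?H" by (simp add: tree_aut_def id_Bij)
    then show "?H \<noteq> {}" by blast
  next
    fix f assume f: "f \<in> ?H"
    then have bij: "f \<in> Bij ?S" by (simp add: tree_aut_def)
    then have bb: "bij_betw f ?S ?S" by (simp add: Bij_def)
    have inj: "inv_into ?S f (f w) = w" if "w \<in> ?S" for w
      using bij_betw_inv_into_left[OF bb that] .
    have edge: "tree_edge (f u) (f v) \<longleftrightarrow> tree_edge u v" if "u \<in> ?S" "v \<in> ?S" for u v
      using f that by (simp add: tree_aut_def)
    have "inv_into ?S f [] = []" using f inj[of "[]"] by (simp add: tree_aut_def)
    moreover have "tree_edge (inv_into ?S f u) (inv_into ?S f v) \<longleftrightarrow> tree_edge u v"
      if "u \<in> ?S" "v \<in> ?S" for u v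
      using edge[OF Bij_inv_into_mem[OF bij that(1)] Bij_inv_into_mem[OF bij that(2)]]
      by (simp only: bij_betw_inv_into_right[OF bb] that)
    ultimately show "inv\<^bsub>BijGroup ?S\<^esub> f \<in> ?H"
      using restrict_inv_into_Bij[OF bij] by (simp add: inv_BijGroup[OF bij] tree_aut_def)
  next
    fix f g assume "f \<in> ?H" "g \<in> ?H"
    then show "f \<otimes>\<^bsub>BijGroup ?S\<^esub> g \<in> ?H"
      using Bij_imp_funcset[of g ?S]
      by (auto simp: tree_aut_def BijGroup_def compose_Bij compose_eq Pi_iff)
  qed
  then have "group (BijGroup ?S\<lparr>carrier := ?H\<rparr>)"
    by (rule subgroup.subgroup_is_group) (rule group_BijGroup)
  then show ?thesis by (simp add: tree_aut_def)
qed

lemma group_hom_tree_action: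
  "group_hom (lamplighter :: ('p::prime_card laurent \<times> int) monoid)
    (tree_aut {..<CARD('p)}) tree_action"
proof -
  have "tree_action (g \<otimes>\<^bsub>lamplighter\<^esub> h)
      = tree_action g \<otimes>\<^bsub>tree_aut {..<CARD('p)}\<^esub> tree_action h" for g h :: "'p laurent \<times> int"
  proof
    fix w
    have "tree_action g \<otimes>\<^bsub>tree_aut {..<CARD('p)}\<^esub> tree_action h
        = compose (lists {..<CARD('p)}) (tree_action g) (tree_action h)"
      by (simp add: tree_aut_def BijGroup_def tree_action_in_Bij)
    then show "tree_action (g \<otimes>\<^bsub>lamplighter\<^esub> h) w
        = (tree_action g \<otimes>\<^bsub>tree_aut {..<CARD('p)}\<^esub> tree_action h) w"
      by (cases "w \<in> lists {..<CARD('p)}")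
        (simp_all only: compose_def tree_action_mult restrict_apply if_True if_False,
         simp add: tree_action_def)
  qed
  then show ?thesis
    by (auto simp: group_hom_def group_hom_axioms_def hom_def group_lamplighter group_tree_aut
        tree_action_in_tree_aut)
qed

section \<open>Faithfulness\<close>

text \<open>Fixing the words of zeros makes \<open>v\<close> divisible by all powers of
  \<open>1 - x\<close>, hence \<open>0\<close>; fixing a \<open>1\<close> followed by zeros then
  does the same for \<open>xpow s - 1\<close>.\<close>

lemma tree_action_eq_one_imp:
  fixes h :: "'p::prime_card laurent \<times> int"
  assumes fix_all: "\<And>w. w \<in> lists {..<CARD('p)} \<Longrightarrow> tree_action h w = w"
  shows "h = \<one>\<^bsub>lamplighter\<^esub>"
proof -
  obtain v s where h: "h = (v, s)" by (cases h)
  have dvd: "(1 - xpow 1) ^ length w dvd v + xpow s * word_bar w - word_bar w"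
    if "w \<in> lists {..<CARD('p)}" for w
    using tree_action_dvd[OF that, of v s] fix_all[OF that] by (simp add: h)
  have zeros: "replicate m 0 \<in> lists {..<CARD('p)}" for m by auto
  have bar: "word_bar (replicate m 0) = (0 :: 'p laurent)" for m
    by (induction m) (simp_all add: word_bar_Cons)
  have "v = 0"
  proof (rule eq_0_if_one_minus_powers_dvd)
    show "(1 - xpow 1) ^ m dvd v" for m
      using dvd[OF zeros[of m]] by (simp add: bar)
  qed
  \<comment> \<open>Makes \<open>1\<close> a letter of the alphabet.\<close>
  have one: "1 < CARD('p)" using prime_card[where 'a = 'p] by (rule prime_gt_1_nat)
  have "xpow s - 1 = (0 :: 'p laurent)"
  proof (rule eq_0_if_one_minus_powers_dvd)
    fix m
    have "(1 - xpow 1) ^ Suc m dvd xpow s - (1 :: 'p laurent)"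
      using dvd[of "1 # replicate m 0"] zeros[of m] one
      by (simp add: word_bar_Cons bar \<open>v = 0\<close>)
    then show "(1 - xpow 1) ^ m dvd xpow s - (1 :: 'p laurent)"
      by (metis dvd_mult_right power_Suc)
  qed
  then have "xpow s = (1 :: 'p laurent)" by simp
  then have "Poly_Mapping.lookup (xpow s :: 'p laurent) 0 = 1"
    by simp
  then have "s = 0" by (auto simp: xpow_def lookup_single when_def split: if_splits)
  then show ?thesis by (simp add: h \<open>v = 0\<close>)
qed

section \<open>Generating sets of the lamplighter group\<close>

lemma pow_shift_generator:
  "(1, 0) [^]\<^bsub>lamplighter\<^esub> i = (of_nat i :: 'p::prime_card laurent, 0 :: int)"
proof -
  interpret group "lamplighter :: ('p laurent \<times> int) monoid" by (rule group_lamplighter)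
  show ?thesis by (induction i) simp_all
qed

text \<open>Conjugating a power of \<open>b\<close> by \<open>a ^ k\<close> yields any monomial at
  position \<open>k\<close>; sums of these give the base group, and a final shift gives every
  element.\<close>

lemma generate_lamplighter:
  "generate lamplighter {(0, 1), (1, 0)} = (UNIV :: ('p::prime_card laurent \<times> int) set)"
proof -
  interpret group "lamplighter :: ('p laurent \<times> int) monoid" by (rule group_lamplighter)
  let ?G = "generate lamplighter {(0, 1), (1 :: 'p laurent, 0 :: int)}"
  have sub: "subgroup ?G lamplighter" by (rule generate_is_subgroup) simp
  have mult: "(v + xpow s * w, s + t) \<in> ?G" if "(v, s) \<in> ?G" "(w, t) \<in> ?G" for v w s t
    using subgroup.m_closed[OF sub that] by simp
  have a: "(0, 1) \<in> ?G" and b: "(1, 0) \<in> ?G" by (auto intro: generate.incl)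
  have "inv\<^bsub>lamplighter\<^esub> (0, 1) = (0 :: 'p laurent, - 1 :: int)"
    by (rule inv_equality) simp_all
  then have a': "(0, - 1) \<in> ?G" using subgroup.m_inv_closed[OF sub a] by simp
  have shift: "(0, s) \<in> ?G" for s
  proof (induction s rule: int_induct[where k = 0])
    case base
    show ?case using subgroup.one_closed[OF sub] by simp
  next
    case (step1 i)
    then show ?case using mult[OF _ a, of 0 i] by simp
  next
    case (step2 i)
    then show ?case using mult[OF _ a', of 0 i] by simp
  qed
  have lamp: "(of_nat n, 0) \<in> ?G" for n
  proof (induction n)
    case 0
    show ?case using shift[of 0] by simp
  next
    case (Suc n)
    then show ?case using mult[OF b] by force
  qed
  have base: "(v, 0) \<in> ?G" for v
  proof (induction v rule: update_induct)
    case const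
    show ?case by (rule shift)
  next
    case (update f k c)
    \<comment> \<open>Every coefficient lies in the prime field, so powers of \<open>b\<close> reach
      all of them.\<close>
    obtain n where n: "c = of_nat n" using surj_of_nat_mod_ring by metis
    have "(xpow k * of_nat n, k) \<in> ?G" using mult[OF shift[of k] lamp[of n]] by simp
    \<comment> \<open>Second half of the conjugation: undoes the shift by \<open>k\<close>.\<close>
    from mult[OF this shift[of "- k"]] have "(xpow k * of_nat n, 0) \<in> ?G" by simp
    moreover have "xpow k * of_nat n = Poly_Mapping.single k c"
      by (simp add: xpow_def n mult_single flip: single_of_nat)
    ultimately have "(Poly_Mapping.single k c + f, 0) \<in> ?G"
      using mult[OF _ update.IH, of "Poly_Mapping.single k c" 0] by simp
    moreover have "Poly_Mapping.update k c f = Poly_Mapping.single k c + f"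
      using update.hyps(1) by (rule update_eq_single_add)
    ultimately show ?case by simp
  qed
  have "(v, s) \<in> ?G" for v s
    using mult[OF base[of v] shift[of s]] by simp
  then show ?thesis by auto
qed

text \<open>The generators are recovered as \<open>a = a\<^sub>0\<close> and \<open>b = a\<^sub>1 a\<^sub>0\<inverse>\<close>.\<close>

lemma generate_automaton_states:
  "generate lamplighter ((\<lambda>i. (of_nat i, 1)) ` {..<CARD('p)})
    = (UNIV :: ('p::prime_card laurent \<times> int) set)"
proof -
  interpret group "lamplighter :: ('p laurent \<times> int) monoid" by (rule group_lamplighter)
  let ?S = "(\<lambda>i. (of_nat i :: 'p laurent, 1 :: int)) ` {..<CARD('p)}"
  have one: "1 < CARD('p)" using prime_card[where 'a = 'p] by (rule prime_gt_1_nat)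
  have sub: "subgroup (generate lamplighter ?S) lamplighter" by (rule generate_is_subgroup) simp
  have "(of_nat 0, 1) \<in> generate lamplighter ?S" "(of_nat 1, 1) \<in> generate lamplighter ?S"
    using one by (intro generate.incl imageI; simp)+
  then have a: "(0, 1) \<in> generate lamplighter ?S" and ba: "(1, 1) \<in> generate lamplighter ?S"
    by simp_all
  have "inv\<^bsub>lamplighter\<^esub> (0, 1) = (0 :: 'p laurent, - 1 :: int)"
    by (rule inv_equality) simp_all
  then have "(1, 0) \<in> generate lamplighter ?S"
    using subgroup.m_closed[OF sub ba subgroup.m_inv_closed[OF sub a]] by simp
  then have "generate lamplighter {(0, 1), (1, 0)} \<subseteq> generate lamplighter ?S"
    using a by (intro generate_subgroup_incl[OF _ sub]) simp
  then show ?thesis unfolding generate_lamplighter by blast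
qed

section \<open>The automaton group\<close>

text \<open>A homomorphism maps a generated subgroup onto the one generated by the images, so the
  automaton group is the full range of the action; faithfulness gives injectivity.\<close>

lemma tree_action_iso:
  "tree_action \<in> iso (lamplighter :: ('p::prime_card laurent \<times> int) monoid)
    (automaton_group (lamplighter_automaton CARD('p)))"
proof -
  interpret group_hom "lamplighter :: ('p laurent \<times> int) monoid"
    "tree_aut {..<CARD('p)}" tree_action
    by (rule group_hom_tree_action)
  let ?S = "(\<lambda>i. (of_nat i :: 'p laurent, 1 :: int)) ` {..<CARD('p)}"
  have "automaton_group (lamplighter_automaton CARD('p))
      = subgroup_generated (tree_aut {..<CARD('p)}) (tree_action ` ?S)"
    by (simp add: automaton_group_def state_map_lamplighter_automaton image_image)
      (simp add: lamplighter_automaton_def)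
  \<comment> \<open>No state is discarded by \<open>subgroup_generated\<close>.\<close>
  moreover have "carrier (tree_aut {..<CARD('p)}) \<inter> tree_action ` ?S = tree_action ` ?S"
    using tree_action_in_tree_aut by blast
  ultimately have A: "automaton_group (lamplighter_automaton CARD('p))
      = (tree_aut {..<CARD('p)})\<lparr>carrier := range (tree_action :: 'p laurent \<times> int \<Rightarrow> _)\<rparr>"
    by (simp add: subgroup_generated_def generate_img generate_automaton_states)
  have "inj_on tree_action (carrier (lamplighter :: ('p laurent \<times> int) monoid))"
    unfolding inj_on_one_iff
  proof (intro allI impI)
    fix h :: "'p laurent \<times> int"
    assume "tree_action h = \<one>\<^bsub>tree_aut {..<CARD('p)}\<^esub>"
    then show "h = \<one>\<^bsub>lamplighter\<^esub>"
      by (intro tree_action_eq_one_imp) (simp add: tree_aut_def BijGroup_def)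
  qed
  then show ?thesis
    using homh by (simp add: A Group.iso_iff hom_def)
qed

theorem proposition3p39:
  fixes p :: nat
    and a b :: "'p::prime_card laurent \<times> int"
    and a' :: "nat \<Rightarrow> 'p laurent \<times> int"
  assumes "p = CARD('p)"
    and "b = (1, 0)" and "a = (0, 1)"
    and "\<And>i. a' i = b [^]\<^bsub>lamplighter\<^esub> i \<otimes>\<^bsub>lamplighter\<^esub> a"
  shows "generate lamplighter {a, b} = carrier lamplighter
    \<and> (\<forall>c\<in>{..<p}. \<forall>w\<in>lists {..<p}. tree_action b (c # w) = ((c + 1) mod p) # w)
    \<and> (\<forall>w\<in>lists {..<p}. w \<noteq> [] \<longrightarrow>
         tree_action a w =
           map (\<lambda>i. if i = 0 then w ! 0 else (w ! i + w ! (i - 1)) mod p) [0..<length w])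
    \<and> wreath_recursion {..<p} (tree_action a)
         (\<lambda>i. tree_action (b [^]\<^bsub>lamplighter\<^esub> i \<otimes>\<^bsub>lamplighter\<^esub> a))
    \<and> (\<forall>i\<in>{..<p}. state_map (lamplighter_automaton p) i = tree_action (a' i))
    \<and> tree_action \<in> iso (lamplighter :: ('p laurent \<times> int) monoid)
        (automaton_group (lamplighter_automaton p))"
proof (intro conjI)
  note [simp] = assms(1-3)
  have pow: "b [^]\<^bsub>lamplighter\<^esub> i \<otimes>\<^bsub>lamplighter\<^esub> a = (of_nat i, 1)" for i
    by (simp add: pow_shift_generator)
  show "generate lamplighter {a, b} = carrier lamplighter"
    by (simp add: generate_lamplighter)
  show "\<forall>c\<in>{..<p}. \<forall>w\<in>lists {..<p}. tree_action b (c # w) = ((c + 1) mod p) # w"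
    using tree_action_translation[where 'p = 'p and i = 1] by simp
  show "\<forall>w\<in>lists {..<p}. w \<noteq> [] \<longrightarrow> tree_action a w =
      map (\<lambda>i. if i = 0 then w ! 0 else (w ! i + w ! (i - 1)) mod p) [0..<length w]"
  proof (intro ballI impI)
    fix w assume w: "w \<in> lists {..<p}" "w \<noteq> []"
    \<comment> \<open>The run reduces the first letter modulo \<open>p\<close> too; this bound
      removes that reduction.\<close>
    then have "w ! 0 < p" by (cases w) auto
    have "tree_action a w = mealy_run (lamplighter_automaton p) 0 w"
      using w mealy_run_lamplighter_automaton[where 'p = 'p and i = 0] by simp
    also have "\<dots> = map (\<lambda>i. if i = 0 then w ! 0 else (w ! i + w ! (i - 1)) mod p) [0..<length w]"
      using \<open>w ! 0 < p\<close> unfolding mealy_run_lamplighter_automaton_nth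
      by (intro map_cong) auto
    finally show "tree_action a w
      = map (\<lambda>i. if i = 0 then w ! 0 else (w ! i + w ! (i - 1)) mod p) [0..<length w]" .
  qed
  show "wreath_recursion {..<p} (tree_action a)
      (\<lambda>i. tree_action (b [^]\<^bsub>lamplighter\<^esub> i \<otimes>\<^bsub>lamplighter\<^esub> a))"
    \<comment> \<open>In state \<open>0\<close> the first letter \<open>c\<close> is kept and the
      section below it is \<open>(of_nat c, 1)\<close>, which is \<open>b ^ c\<close> times
      \<open>a\<close>.\<close>
    unfolding wreath_recursion_def pow
    using tree_action_Cons[where 'p = 'p and i = 0]
    by (simp add: tree_action_Nil)
  show "\<forall>i\<in>{..<p}. state_map (lamplighter_automaton p) i = tree_action (a' i)"
    unfolding assms(4) pow by (simp add: state_map_lamplighter_automaton)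
  show "tree_action \<in> iso (lamplighter :: ('p laurent \<times> int) monoid)
      (automaton_group (lamplighter_automaton p))"
    by (simp add: tree_action_iso)
qed

end
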